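(* Let $n$ and $d$ be positive integers with $d\le n$. Then $$P(n,d)\ \ge\ \frac{2\cdot n!}{V(n,d-1)+P[n,d-1]}.$$
   Context: $S_n$ is the group of permutations of $Z_n=\{0,1,\ldots,n-1\}$. The Hamming distance $d(\mathbf{x},\mathbf{y})$ of $\mathbf{x},\mathbf{y}\in S_n$ is the number of $i\in Z_n$ with $\mathbf{x}(i)\neq\mathbf{y}(i)$. An $(n,d)$ permutation array (PA) is a subset $C\subseteq S_n$ in which any two distinct elements have distance at least $d$; $P(n,d)$ is the maximum size of an $(n,d)$ PA. $P[n,d-1]$ is the maximum size of a subset $\Gamma\subseteq S_n$ such that any two distinct elements of $\Gamma$ have distance at most $d-1$. $D_k$ is the number of derangements (permutations without fixed points) of $k$ elements, with $D_0=1$. $V(n,d-1)=\sum_{i=0}^{d-1}\binom{n}{i}D_i$. *)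

theory Defs
  imports Complex_Main "HOL-Combinatorics.Permutations"
begin

(* A permutation of Z_n is a function on nat that permutes {..<n}; in particular it fixes
   every i \<ge> n, so that equality of functions is equality of permutations of Z_n. *)
definition Sn :: "nat \<Rightarrow> (nat \<Rightarrow> nat) set" where
  "Sn n = {p. p permutes {..<n}}"

definition hamming :: "nat \<Rightarrow> (nat \<Rightarrow> nat) \<Rightarrow> (nat \<Rightarrow> nat) \<Rightarrow> nat" where
  "hamming n x y = card {i \<in> {..<n}. x i \<noteq> y i}"

definition perm_array :: "nat \<Rightarrow> nat \<Rightarrow> (nat \<Rightarrow> nat) set \<Rightarrow> bool" where
  "perm_array n d C \<longleftrightarrow>
     C \<subseteq> Sn n \<and> (\<forall>x\<in>C. \<forall>y\<in>C. x \<noteq> y \<longrightarrow> hamming n x y \<ge> d)"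

definition perm_anticode :: "nat \<Rightarrow> nat \<Rightarrow> (nat \<Rightarrow> nat) set \<Rightarrow> bool" where
  "perm_anticode n r \<Gamma> \<longleftrightarrow>
     \<Gamma> \<subseteq> Sn n \<and> (\<forall>x\<in>\<Gamma>. \<forall>y\<in>\<Gamma>. x \<noteq> y \<longrightarrow> hamming n x y \<le> r)"

(* The two maxima P(n,d) and P[n,r]; both range over finite nonempty sets, since Sn n is finite
   and the empty set always qualifies. *)
definition max_array_size :: "nat \<Rightarrow> nat \<Rightarrow> nat" where
  "max_array_size n d = Max (card ` {C. perm_array n d C})"

definition max_anticode_size :: "nat \<Rightarrow> nat \<Rightarrow> nat" where
  "max_anticode_size n r = Max (card ` {\<Gamma>. perm_anticode n r \<Gamma>})"

(* For k = 0 the only permutation is the identity, which qualifies vacuously, so the value is 1. *)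
definition derangements :: "nat \<Rightarrow> nat" where
  "derangements k = card {p \<in> Sn k. \<forall>i<k. p i \<noteq> i}"

definition ball_volume :: "nat \<Rightarrow> nat \<Rightarrow> nat" where
  "ball_volume n r = (\<Sum>i=0..r. (n choose i) * derangements i)"

end

(* Join two permutations of Z_n by an edge when their distance is at most d - 1: independent sets
   are the (n,d) arrays, cliques are the anticodes, and closed neighbourhoods are Hamming balls of
   size V(n,d-1). The bound is then Fajtlowicz's inequality 2|V| \<le> \<alpha> (\<Delta> + 1 + \<omega>). For a maximum
   independent set I, count the edges from I to V: every vertex is covered at least once, and the
   vertices covered only by a given i in I form a clique, since otherwise i could be exchanged for
   two nonadjacent vertices. *)
theory Submission
  imports Defs
begin

\<comment> \<open>E is closed adjacency: reflexive, so that v bounds the degree plus one.\<close>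
lemma fajtlowicz:
  fixes E :: "'a \<Rightarrow> 'a \<Rightarrow> bool"
  assumes fin: "finite V"
    and refl: "\<And>x. x \<in> V \<Longrightarrow> E x x"
    and sym: "\<And>x y. x \<in> V \<Longrightarrow> y \<in> V \<Longrightarrow> E x y \<Longrightarrow> E y x"
    and deg: "\<And>x. x \<in> V \<Longrightarrow> card {y \<in> V. E x y} \<le> v"
    and clique: "\<And>K. K \<subseteq> V \<Longrightarrow> (\<And>x y. x \<in> K \<Longrightarrow> y \<in> K \<Longrightarrow> x \<noteq> y \<Longrightarrow> E x y) \<Longrightarrow> card K \<le> w"
    and I: "I \<subseteq> V" and indep: "\<And>x y. x \<in> I \<Longrightarrow> y \<in> I \<Longrightarrow> x \<noteq> y \<Longrightarrow> \<not> E x y"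
    and maximum: "\<And>J. J \<subseteq> V \<Longrightarrow> (\<And>x y. x \<in> J \<Longrightarrow> y \<in> J \<Longrightarrow> x \<noteq> y \<Longrightarrow> \<not> E x y) \<Longrightarrow> card J \<le> card I"
  shows "2 * card V \<le> card I * (v + w)"
proof -
  define r where "r x = card {i \<in> I. E i x}" for x
  define K where "K i = {x \<in> V. {j \<in> I. E j x} = {i}}" for i
  have finI: "finite I"
    using I fin finite_subset by blast
  \<comment> \<open>An uncovered \<open>x\<close> lies outside \<open>I\<close> by reflexivity and
    could be added to \<open>I\<close>, against maximality.\<close>
  have r_pos: "1 \<le> r x" if x: "x \<in> V" for x
  proof (rule ccontr)
    assume "\<not> 1 \<le> r x"
    then have none: "\<not> E i x" if "i \<in> I" for i
      using that finI by (auto simp: r_def not_le card_eq_0_iff)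
    then have "x \<notin> I"
      using refl[OF x] by blast
    moreover have "card (insert x I) \<le> card I"
      by (rule maximum) (use x I none indep sym in blast)+
    ultimately show False
      using finI by simp
  qed
  have card_K: "card (K i) \<le> w" if i: "i \<in> I" for i
  proof (rule clique)
    show "K i \<subseteq> V"
      by (auto simp: K_def)
    fix x y assume xy: "x \<in> K i" "y \<in> K i" "x \<noteq> y"
    show "E x y"
    proof (rule ccontr)
      assume nE: "\<not> E x y"
      have V: "x \<in> V" "y \<in> V"
        using xy by (auto simp: K_def)
      have only: "\<not> E j x" "\<not> E j y" if "j \<in> I - {i}" for j
        using xy that by (auto simp: K_def)
      \<comment> \<open>By reflexivity a member of \<open>I - {i}\<close> is covered by itself,
        which \<open>only\<close> forbids for \<open>x\<close> and \<open>y\<close>. Hence the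
        exchange set \<open>?J\<close> has exactly one element more than \<open>I\<close>.\<close>
      have notin: "x \<notin> I - {i}" "y \<notin> I - {i}"
        using only refl V by blast+
      let ?J = "insert x (insert y (I - {i}))"
      have "card ?J \<le> card I"
      proof (rule maximum)
        show "?J \<subseteq> V"
          using V I by blast
        fix a b assume ab: "a \<in> ?J" "b \<in> ?J" "a \<noteq> b"
        have "\<not> E y x"
          using nE sym V by blast
        moreover have "\<not> E x j" "\<not> E y j" if "j \<in> I - {i}" for j
          using only[OF that] sym V that I by blast+
        ultimately show "\<not> E a b"
          using ab nE only indep by blast
      qed
      moreover have "card ?J = Suc (Suc (card (I - {i})))"
        using notin xy(3) finI by simp
      moreover have "Suc (card (I - {i})) = card I"
        using i finI by (metis card_Suc_Diff1)
      ultimately show False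
        by simp
    qed
  qed
  \<comment> \<open>The single member of \<open>I\<close> covering \<open>x\<close> is the index of
    the clique that contains \<open>x\<close>.\<close>
  have "{x \<in> V. r x = 1} \<subseteq> (\<Union>i\<in>I. K i)"
    by (auto simp: r_def K_def card_1_singleton_iff)
  moreover have "finite (\<Union>i\<in>I. K i)"
    by (rule finite_subset[OF _ fin]) (auto simp: K_def)
  ultimately have "card {x \<in> V. r x = 1} \<le> card (\<Union>i\<in>I. K i)"
    by (rule card_mono[rotated])
  also have "\<dots> \<le> (\<Sum>i\<in>I. card (K i))"
    by (rule card_UN_le[OF finI])
  also have "\<dots> \<le> card I * w"
    using sum_bounded_above[of I "\<lambda>i. card (K i)" w] card_K by simp
  finally have once: "card {x \<in> V. r x = 1} \<le> card I * w" .
  \<comment> \<open>Double counting of the pairs \<open>(i, x)\<close> in \<open>I\<close> times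
    \<open>V\<close> with \<open>E i x\<close>.\<close>
  have "(\<Sum>x\<in>V. r x) = (\<Sum>i\<in>I. card {x \<in> V. E i x})"
    unfolding r_def by (rule sum_multicount_gen[OF fin finI]) simp
  also have "\<dots> \<le> card I * v"
    using sum_bounded_above[of I "\<lambda>i. card {x \<in> V. E i x}" v] deg I by auto
  finally have total: "(\<Sum>x\<in>V. r x) \<le> card I * v" .
  have "2 * card V = (\<Sum>x\<in>V. 2)"
    by simp
  \<comment> \<open>Since \<open>r x\<close> is positive, it falls short of 2 only when it equals 1;
    the extra unit makes up for that.\<close>
  also have "\<dots> \<le> (\<Sum>x\<in>V. r x + (if r x = 1 then 1 else 0))"
    using r_pos by (intro sum_mono) force
  also have "\<dots> = (\<Sum>x\<in>V. r x) + card {x \<in> V. r x = 1}"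
    using fin by (simp add: sum.distrib flip: sum.inter_filter)
  also have "\<dots> \<le> card I * (v + w)"
    using once total by (simp add: distrib_left)
  finally show ?thesis .
qed

lemma finite_Sn: "finite (Sn n)"
  by (simp add: Sn_def finite_permutations)

lemma card_Sn: "card (Sn n) = fact n"
  by (simp add: Sn_def card_permutations)

lemma hamming_self [simp]: "hamming n x x = 0"
  by (simp add: hamming_def)

lemma hamming_commute: "hamming n x y = hamming n y x"
  by (simp add: hamming_def eq_commute)

text \<open>An enumeration of \<open>B\<close> carries derangements of an initial segment of the
  naturals to derangements of \<open>B\<close>. This is needed because supports of permutations are
  arbitrary subsets of \<open>{..<n}\<close>.\<close>

lemma card_derangements_on:
  assumes "finite B"
  shows "card {p. p permutes B \<and> (\<forall>x\<in>B. p x \<noteq> x)} = derangements (card B)"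
proof -
  obtain f where "bij_betw f {..<card B} B"
    using ex_bij_betw_nat_finite[OF assms] by (auto simp: atLeast0LessThan)
  from bij_betw_same_card[OF bij_betw_derangements[OF this]] show ?thesis
    by (simp add: derangements_def Sn_def Ball_def)
qed

text \<open>The distance from \<open>id\<close> is the size of the support, and a permutation is a
  derangement of its support. So the sphere splits according to the support, a
  \<open>k\<close>-subset of \<open>{..<n}\<close>.\<close>

lemma card_hamming_sphere: "card {p \<in> Sn n. hamming n id p = k} = (n choose k) * derangements k"
proof -
  let ?S = "{B. B \<subseteq> {..<n} \<and> card B = k}"
  let ?D = "\<lambda>B. {p. p permutes B \<and> (\<forall>x\<in>B. p x \<noteq> x)}"
  have finB: "finite B" if "B \<in> ?S" for B
    using that finite_subset by auto
  have "{p \<in> Sn n. hamming n id p = k} = (\<Union>B\<in>?S. ?D B)"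
  proof (intro set_eqI iffI)
    fix p assume p: "p \<in> {p \<in> Sn n. hamming n id p = k}"
    let ?B = "{i \<in> {..<n}. id i \<noteq> p i}"
    have "p permutes ?B"
      by (rule permutes_superset[of p "{..<n}"]) (use p in \<open>auto simp: Sn_def\<close>)
    with p have "?B \<in> ?S" "p \<in> ?D ?B"
      by (auto simp: hamming_def)
    then show "p \<in> (\<Union>B\<in>?S. ?D B)"
      by blast
  next
    fix p assume "p \<in> (\<Union>B\<in>?S. ?D B)"
    then obtain B where B: "B \<subseteq> {..<n}" "card B = k" "p permutes B" "\<forall>x\<in>B. p x \<noteq> x"
      by blast
    have "{i \<in> {..<n}. id i \<noteq> p i} = B"
      using B permutes_not_in[OF B(3)] by fastforce
    then show "p \<in> {p \<in> Sn n. hamming n id p = k}"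
      using B permutes_subset[OF B(3) B(1)] by (simp add: Sn_def hamming_def)
  qed
  moreover have "card (\<Union>B\<in>?S. ?D B) = (\<Sum>B\<in>?S. card (?D B))"
  proof (rule card_UN_disjoint)
    show "\<forall>B\<in>?S. finite (?D B)"
      using finB by (auto intro: finite_subset[OF _ finite_permutations])
    show "\<forall>A\<in>?S. \<forall>B\<in>?S. A \<noteq> B \<longrightarrow> ?D A \<inter> ?D B = {}"
    proof (intro ballI impI equals0I)
      fix A B p assume "A \<noteq> B" and p: "p \<in> ?D A \<inter> ?D B"
      \<comment> \<open>A derangement of a set moves precisely the points of that set, so
        \<open>p\<close> determines it.\<close>
      have "A = {x. p x \<noteq> x}" "B = {x. p x \<noteq> x}"
        using p permutes_not_in[of p A] permutes_not_in[of p B] by blast+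
      with \<open>A \<noteq> B\<close> show False
        by simp
    qed
  qed simp
  moreover have "(\<Sum>B\<in>?S. card (?D B)) = (\<Sum>B\<in>?S. derangements k)"
    using card_derangements_on finB by (intro sum.cong) auto
  ultimately show ?thesis
    using n_subsets[of "{..<n}" k] by simp
qed

lemma card_hamming_ball_id: "card {p \<in> Sn n. hamming n id p \<le> r} = ball_volume n r"
proof -
  have "{p \<in> Sn n. hamming n id p \<le> r} = (\<Union>k\<in>{0..r}. {p \<in> Sn n. hamming n id p = k})"
    by auto
  also have "card \<dots> = (\<Sum>k=0..r. card {p \<in> Sn n. hamming n id p = k})"
    by (rule card_UN_disjoint) (auto simp: finite_Sn)
  finally show ?thesis
    unfolding card_hamming_sphere ball_volume_def .
qed

text \<open>Left translation by \<open>x\<close> preserves distances because \<open>x\<close> is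
  injective, so it maps the ball around \<open>id\<close> bijectively onto the ball around
  \<open>x\<close>.\<close>

lemma card_hamming_ball:
  assumes "x \<in> Sn n"
  shows "card {y \<in> Sn n. hamming n x y \<le> r} = ball_volume n r"
proof -
  have x: "x permutes {..<n}"
    using assms by (simp add: Sn_def)
  have translate: "hamming n x (x \<circ> p) = hamming n id p" for p
    using permutes_inj[OF x] by (simp add: hamming_def inj_eq)
  have "bij_betw ((\<circ>) x) {p \<in> Sn n. hamming n id p \<le> r} {y \<in> Sn n. hamming n x y \<le> r}"
  proof (rule bij_betw_byWitness[of _ "(\<circ>) (inv x)"])
    have cancel: "x \<circ> (inv x \<circ> y) = y" for y
      using permutes_inv_o(1)[OF x] by (simp flip: comp_assoc)
    have translate_inv: "hamming n id (inv x \<circ> y) = hamming n x y" for y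
      using translate[of "inv x \<circ> y"] unfolding cancel by (rule sym)
    show "\<forall>y\<in>{y \<in> Sn n. hamming n x y \<le> r}. x \<circ> (inv x \<circ> y) = y"
      using cancel by blast
    show "\<forall>p\<in>{p \<in> Sn n. hamming n id p \<le> r}. inv x \<circ> (x \<circ> p) = p"
      using permutes_inv_o(2)[OF x] by (simp flip: comp_assoc)
    show "(\<circ>) x ` {p \<in> Sn n. hamming n id p \<le> r} \<subseteq> {y \<in> Sn n. hamming n x y \<le> r}"
      unfolding image_subset_iff mem_Collect_eq translate Sn_def
      using permutes_compose[OF _ x] by blast
    show "(\<circ>) (inv x) ` {y \<in> Sn n. hamming n x y \<le> r} \<subseteq> {p \<in> Sn n. hamming n id p \<le> r}"
      unfolding image_subset_iff mem_Collect_eq translate_inv Sn_def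
      using permutes_compose[OF _ permutes_inv[OF x]] by blast
  qed
  from bij_betw_same_card[OF this] show ?thesis
    unfolding card_hamming_ball_id by (rule sym)
qed

lemma finite_perm_arrays: "finite {C. perm_array n d C}"
  by (rule finite_subset[of _ "Pow (Sn n)"]) (auto simp: perm_array_def finite_Sn)

lemma finite_perm_anticodes: "finite {C. perm_anticode n r C}"
  by (rule finite_subset[of _ "Pow (Sn n)"]) (auto simp: perm_anticode_def finite_Sn)

lemma card_le_max_array_size: "perm_array n d C \<Longrightarrow> card C \<le> max_array_size n d"
  unfolding max_array_size_def by (intro Max_ge) (auto simp: finite_perm_arrays)

lemma card_le_max_anticode_size: "perm_anticode n r C \<Longrightarrow> card C \<le> max_anticode_size n r"
  unfolding max_anticode_size_def by (intro Max_ge) (auto simp: finite_perm_anticodes)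

lemma obtain_max_array:
  obtains C where "perm_array n d C" "card C = max_array_size n d"
proof -
  have "perm_array n d {}"
    by (simp add: perm_array_def)
  then have "max_array_size n d \<in> card ` {C. perm_array n d C}"
    unfolding max_array_size_def by (intro Max_in) (auto simp: finite_perm_arrays)
  then show thesis
    using that by auto
qed

theorem theorem5:
  fixes n d :: nat
  assumes "n > 0" and "d > 0" and "d \<le> n"
  shows "real (max_array_size n d) \<ge>
           2 * fact n / (real (ball_volume n (d - 1)) + real (max_anticode_size n (d - 1)))"
proof -
  let ?v = "ball_volume n (d - 1)" and ?w = "max_anticode_size n (d - 1)"
  obtain C where C: "perm_array n d C" "card C = max_array_size n d"
    by (rule obtain_max_array)
  \<comment> \<open>Subtraction on \<open>nat\<close> truncates: for \<open>d = 0\<close> the bound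
    \<open>d - 1\<close> would be 0, and the equivalence would fail at distance 0.\<close>
  have far: "\<not> hamming n x y \<le> d - 1 \<longleftrightarrow> d \<le> hamming n x y" for x y
    using \<open>d > 0\<close> by linarith
  have "2 * card (Sn n) \<le> card C * (?v + ?w)"
  proof (rule fajtlowicz[where E = "\<lambda>x y. hamming n x y \<le> d - 1"])
    show "card K \<le> ?w"
      if "K \<subseteq> Sn n" "\<And>x y. x \<in> K \<Longrightarrow> y \<in> K \<Longrightarrow> x \<noteq> y \<Longrightarrow> hamming n x y \<le> d - 1" for K
      using that by (intro card_le_max_anticode_size) (simp add: perm_anticode_def)
    show "card J \<le> card C"
      if "J \<subseteq> Sn n" "\<And>x y. x \<in> J \<Longrightarrow> y \<in> J \<Longrightarrow> x \<noteq> y \<Longrightarrow> \<not> hamming n x y \<le> d - 1" for J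
      using that unfolding C(2) far by (intro card_le_max_array_size) (simp add: perm_array_def)
  qed (use C(1) far in \<open>auto simp: finite_Sn hamming_commute card_hamming_ball perm_array_def\<close>)
  then have "2 * fact n \<le> max_array_size n d * (?v + ?w)"
    by (simp add: card_Sn C(2))
  then have "real (2 * fact n) \<le> real (max_array_size n d * (?v + ?w))"
    by (rule of_nat_mono)
  then show ?thesis
    \<comment> \<open>Division by zero yields 0, which settles the first case; in the second the
      denominator is positive and can be cleared.\<close>
    by (cases "?v + ?w = 0") (simp_all add: divide_le_eq)
qed

end
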